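(* Let $(G,\beta)$ be an edge-labeled graph on vertices $v_1,\dots,v_n$, with module $M_v=m_v\mathbb{Z}$ at each vertex $v$ and module $\mathbb{Z}/r_{uv}\mathbb{Z}$ at each edge $uv$, and for each $i=1,\dots,n$ let $F^{(i)}=(0,\dots,0,f^{(i)}_{v_i},\dots,f^{(i)}_{v_n})$ be an $i$-th flow-up class on $(G,\beta)$. The following are equivalent: (1) The set $\{F^{(1)},\dots,F^{(n)}\}$ forms a module basis (over $\mathbb{Z}$) for $\hat{R}_G$. (2) For each $i\in\{1,\dots,n\}$ and each flow-up class $A^{(i)}=(0,\dots,0,g_{v_i},\dots,g_{v_n})\in\hat{\mathcal{F}}_i$, the entry $g_{v_i}$ is a multiple of the entry $f^{(i)}_{v_i}$.
   Context: Setting: $G=(V,E)$ is a finite graph with ordered vertex set $V=\{v_1,\dots,v_n\}$, whose edges are unordered pairs $uv$ of distinct vertices. Each vertex $v$ is assigned the $\mathbb{Z}$-module $M_v=m_v\mathbb{Z}$ ($m_v\in\mathbb{Z}$), each edge $uv$ is assigned the $\mathbb{Z}$-module $\beta(uv)=\mathbb{Z}/r_{uv}\mathbb{Z}$ ($r_{uv}\in\mathbb{Z}$), and for each vertex $v$ incident to an edge $e$ the map $\varphi_v:M_v\to\mathbb{Z}/r_e\mathbb{Z}$ is $a\mapsto a+r_e\mathbb{Z}$. The pair $(G,\beta)$ is called an edge-labeled graph. An (extending generalized) spline on $(G,\beta)$ is a tuple $(f_{v_1},\dots,f_{v_n})\in\prod_i m_{v_i}\mathbb{Z}$ with $f_u\equiv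 f_v \pmod{r_{uv}}$ for every edge $uv$. The $\mathbb{Z}$-module of all splines is $\hat{R}_G$. An $i$-th flow-up class is a spline with $f_{v_i}\neq 0$ and $f_{v_s}=0$ for all $s<i$; the set of all $i$-th flow-up classes is $\hat{\mathcal{F}}_i$. *)

theory Defs
  imports Complex_Main "HOL-Library.Function_Algebras" "HOL-Number_Theory.Cong"
begin

definition scale_tuple :: "int \<Rightarrow> ('v \<Rightarrow> int) \<Rightarrow> 'v \<Rightarrow> int" where
  "scale_tuple c f = (\<lambda>u. c * f u)"

global_interpretation tuple: module "scale_tuple :: int \<Rightarrow> ('v \<Rightarrow> int) \<Rightarrow> 'v \<Rightarrow> int"
  by unfold_locales (auto simp: scale_tuple_def fun_eq_iff algebra_simps)

definition tuple_module_basis :: "('v \<Rightarrow> int) set \<Rightarrow> ('v \<Rightarrow> int) set \<Rightarrow> bool" where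
  "tuple_module_basis B R \<longleftrightarrow> tuple.independent B \<and> tuple.span B = R"

text \<open>The map \<open>v\<close> enumerates the vertices as \<open>v 1, \<dots>, v n\<close>; edges are two-element sets of vertices.\<close>

locale ordered_graph =
  fixes V :: "'v set" and E :: "'v set set" and n :: nat and v :: "nat \<Rightarrow> 'v"
  assumes vertices: "bij_betw v {1..n} V"
    and edges: "\<And>e. e \<in> E \<Longrightarrow> \<exists>a\<in>V. \<exists>b\<in>V. a \<noteq> b \<and> e = {a, b}"

definition vertex_module :: "('v \<Rightarrow> int) \<Rightarrow> 'v \<Rightarrow> int set" where
  "vertex_module m a = {m a * k | k. True}"

text \<open>Tuples indexed by \<open>V\<close> are functions vanishing outside \<open>V\<close>, so that equality of tuples is
  equality of functions. The congruence is equality of the images in \<open>\<int>/r\<int>\<close>, for every integer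
  \<open>r\<close>: it is equality for \<open>r = 0\<close>, and the sign of \<open>r\<close> is irrelevant.\<close>

definition splines ::
    "'v set \<Rightarrow> 'v set set \<Rightarrow> ('v \<Rightarrow> int) \<Rightarrow> ('v set \<Rightarrow> int) \<Rightarrow> ('v \<Rightarrow> int) set" where
  "splines V E m r = {f. (\<forall>a. a \<notin> V \<longrightarrow> f a = 0) \<and> (\<forall>a\<in>V. f a \<in> vertex_module m a) \<and>
     (\<forall>a b. {a, b} \<in> E \<longrightarrow> [f a = f b] (mod r {a, b}))}"

lemma subspace_splines: "tuple.subspace (splines V E m r)"
proof (rule tuple.subspaceI)
  show "0 \<in> splines V E m r"
    by (auto simp: splines_def vertex_module_def)
next
  fix f g assume "f \<in> splines V E m r" "g \<in> splines V E m r"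
  then show "f + g \<in> splines V E m r"
    by (auto simp: splines_def vertex_module_def cong_add dest!: bspec)
       (metis distrib_left)
next
  fix c f assume "f \<in> splines V E m r"
  then show "scale_tuple c f \<in> splines V E m r"
    by (auto simp: splines_def vertex_module_def scale_tuple_def cong_scalar_left dest!: bspec)
qed

definition flow_up_classes ::
    "'v set \<Rightarrow> 'v set set \<Rightarrow> ('v \<Rightarrow> int) \<Rightarrow> ('v set \<Rightarrow> int) \<Rightarrow> (nat \<Rightarrow> 'v) \<Rightarrow> nat \<Rightarrow> ('v \<Rightarrow> int) set"
  where "flow_up_classes V E m r v i =
    {f \<in> splines V E m r. f (v i) \<noteq> 0 \<and> (\<forall>s. 1 \<le> s \<and> s < i \<longrightarrow> f (v s) = 0)}"

end

(* The tuples F i are triangular with nonzero diagonal F i (v i), so they are independent, and the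
   leading entry of a linear combination whose first i - 1 entries vanish is an integer multiple
   of F i (v i). Conversely, divisibility of the leading entries allows one to clear the entries
   of an arbitrary spline one vertex at a time, in the order of the vertices. *)

theory Submission imports Defs begin

declare One_nat_def [simp del]

lemma sum_fun_apply: "(\<Sum>j\<in>S. f j) x = (\<Sum>j\<in>S. f j x)"
  for f :: "'i \<Rightarrow> 'v \<Rightarrow> int"
  by (induction S rule: infinite_finite_induct) auto

locale flow_up_family =
  fixes V :: "'v set" and E :: "'v set set" and n :: nat and v :: "nat \<Rightarrow> 'v"
    and m :: "'v \<Rightarrow> int" and r :: "'v set \<Rightarrow> int" and F :: "nat \<Rightarrow> 'v \<Rightarrow> int"
  assumes vertices: "v ` {1..n} = V"
    and flow_up: "\<And>i. i \<in> {1..n} \<Longrightarrow> F i \<in> flow_up_classes V E m r v i"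
begin

lemma diagonal_nonzero: "i \<in> {1..n} \<Longrightarrow> F i (v i) \<noteq> 0"
  using flow_up[of i] by (simp add: flow_up_classes_def)

lemma vanishes_below: "\<lbrakk>i \<in> {1..n}; 1 \<le> s; s < i\<rbrakk> \<Longrightarrow> F i (v s) = 0"
  using flow_up[of i] by (simp add: flow_up_classes_def)

lemma in_splines: "i \<in> {1..n} \<Longrightarrow> F i \<in> splines V E m r"
  using flow_up[of i] by (simp add: flow_up_classes_def)

text \<open>For \<open>i < j\<close> the tuples differ at \<open>v i\<close>, where only
  \<open>F j\<close> vanishes. Injectivity lets sums over the set of tuples be reindexed by
  \<open>{1..n}\<close>.\<close>

lemma inj_on_family: "inj_on F {1..n}"
proof (rule linorder_inj_onI)
  fix i j assume "i < j" "i \<in> {1..n}" "j \<in> {1..n}"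
  then show "F i \<noteq> F j"
    using vanishes_below[of j i] diagonal_nonzero[of i] by auto
qed auto

lemma combination_family:
  "(\<Sum>f\<in>F ` {1..n}. scale_tuple (c f) f) x = (\<Sum>j\<in>{1..n}. c (F j) * F j x)"
  by (simp add: sum_fun_apply sum.reindex[OF inj_on_family] scale_tuple_def)

text \<open>At \<open>v i\<close> the terms with \<open>j > i\<close> vanish by the flow-up
  property, those with \<open>j < i\<close> by the assumption on \<open>c\<close>.\<close>

lemma leading_entry:
  assumes i: "i \<in> {1..n}" and c: "\<And>j. \<lbrakk>1 \<le> j; j < i\<rbrakk> \<Longrightarrow> c j = 0"
  shows "(\<Sum>j\<in>{1..n}. c j * F j (v i)) = c i * F i (v i)"
proof -
  have "c j * F j (v i) = 0" if "j \<in> {1..n} - {i}" for j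
    using that i c[of j] vanishes_below[of j i] by (cases "j < i") auto
  then have "(\<Sum>j\<in>{1..n} - {i}. c j * F j (v i)) = 0"
    by (intro sum.neutral ballI)
  then show ?thesis
    using i by (simp add: sum.remove[of "{1..n}" i])
qed

text \<open>Forward substitution: once all earlier coefficients are zero, the entry at
  \<open>v s\<close> reduces to \<open>c s * F s (v s)\<close>, whose second factor is nonzero. The
  cutoff \<open>i\<close> stays free to serve both independence and divisibility.\<close>

lemma coefficients_vanish:
  assumes "\<And>s. \<lbrakk>1 \<le> s; s < i\<rbrakk> \<Longrightarrow> (\<Sum>j\<in>{1..n}. c j * F j (v s)) = 0"
    and "1 \<le> s" "s < i" "s \<le> n"
  shows "c s = 0"
  using assms(2-4)
proof (induction s rule: less_induct)
  case (less s)
  then have "s \<in> {1..n}" by simp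
  moreover have "c j = 0" if "1 \<le> j" "j < s" for j
    using less that by simp
  ultimately have "c s * F s (v s) = 0"
    using leading_entry[of s c] assms(1)[of s] less.prems by simp
  then show ?case
    using diagonal_nonzero[OF \<open>s \<in> {1..n}\<close>] by simp
qed

lemma independent_family: "tuple.independent (F ` {1..n})"
proof -
  have "c (F s) = 0"
    if "(\<Sum>f\<in>F ` {1..n}. scale_tuple (c f) f) = 0" and "s \<in> {1..n}" for c s
  \<comment> \<open>The cutoff \<open>Suc n\<close> makes \<open>s < i\<close> cover every index up
    to \<open>n\<close>.\<close>
  proof (rule coefficients_vanish[where i = "Suc n" and c = "\<lambda>j. c (F j)"])
    show "(\<Sum>j\<in>{1..n}. c (F j) * F j (v t)) = 0" for t
      using that(1) by (simp flip: combination_family)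
  qed (use that(2) in auto)
  then show ?thesis
    by (auto simp: tuple.dependent_finite)
qed

lemma span_family_subset: "tuple.span (F ` {1..n}) \<subseteq> splines V E m r"
  using in_splines by (intro tuple.span_minimal subspace_splines) blast

text \<open>The coefficients before \<open>i\<close> vanish, so the one at \<open>F i\<close> is the
  required quotient.\<close>

lemma dvd_leading_entry:
  assumes span: "A \<in> tuple.span (F ` {1..n})" and i: "i \<in> {1..n}"
    and zero: "\<And>s. \<lbrakk>1 \<le> s; s < i\<rbrakk> \<Longrightarrow> A (v s) = 0"
  shows "F i (v i) dvd A (v i)"
proof -
  obtain c where A: "A = (\<Sum>f\<in>F ` {1..n}. scale_tuple (c f) f)"
    using span by (auto simp: tuple.span_finite)
  have "c (F j) = 0" if "1 \<le> j" "j < i" for j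
    using that i zero coefficients_vanish[where i = i and c = "\<lambda>j. c (F j)" and s = j]
    unfolding A combination_family by simp
  then have "A (v i) = c (F i) * F i (v i)"
    unfolding A combination_family
    using leading_entry[OF i, where c = "\<lambda>j. c (F j)"] by blast
  then show ?thesis by simp
qed

lemma spline_in_span:
  assumes dvd: "\<And>i A. \<lbrakk>i \<in> {1..n}; A \<in> flow_up_classes V E m r v i\<rbrakk> \<Longrightarrow> F i (v i) dvd A (v i)"
    and "i \<le> Suc n" "1 \<le> i" "f \<in> splines V E m r" "\<And>s. \<lbrakk>1 \<le> s; s < i\<rbrakk> \<Longrightarrow> f (v s) = 0"
  shows "f \<in> tuple.span (F ` {1..n})"
  using assms(2-)
\<comment> \<open>The induction descends from \<open>Suc n\<close>. The spline is generalized
  because each step replaces it by one with one more leading zero.\<close>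
proof (induction i arbitrary: f rule: inc_induct)
  case base
  \<comment> \<open>Here \<open>i = Suc n\<close>: all vertex entries are zero, and splines vanish
    outside \<open>V\<close> by convention.\<close>
  have "f a = 0" for a
  proof (cases "a \<in> V")
    case True
    then show ?thesis using base vertices by force
  next
    case False
    then show ?thesis using base by (simp add: splines_def)
  qed
  then have "f = 0" by (simp add: fun_eq_iff)
  then show ?case by (simp only: tuple.span_zero)
next
  case (step i)
  then have i: "i \<in> {1..n}" by simp
  have "F i (v i) dvd f (v i)"
  \<comment> \<open>With a zero entry, \<open>f\<close> is no \<open>i\<close>-th flow-up class and
    \<open>dvd\<close> says nothing about it, but everything divides 0.\<close>
  proof (cases "f (v i) = 0")
    case False
    then show ?thesis
      using step.prems by (intro dvd[OF i]) (simp add: flow_up_classes_def)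
  qed simp
  then obtain k where k: "f (v i) = F i (v i) * k" by blast
  \<comment> \<open>This clears the entry at \<open>v i\<close> and keeps the earlier zeros, since
    \<open>F i\<close> vanishes there.\<close>
  let ?g = "f - scale_tuple k (F i)"
  have "?g \<in> tuple.span (F ` {1..n})"
  proof (rule step.IH)
    show "?g \<in> splines V E m r"
      using step.prems in_splines[OF i]
      by (intro tuple.subspace_diff tuple.subspace_scale subspace_splines)
    show "?g (v s) = 0" if "1 \<le> s" "s < Suc i" for s
      using that step.prems k vanishes_below[OF i, of s]
      by (cases "s = i") (auto simp: scale_tuple_def)
  qed simp
  moreover have "scale_tuple k (F i) \<in> tuple.span (F ` {1..n})"
    using i by (intro tuple.span_scale tuple.span_base) simp
  ultimately have "?g + scale_tuple k (F i) \<in> tuple.span (F ` {1..n})"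
    by (rule tuple.span_add)
  then show ?case by simp
qed

end

theorem theorem4p1:
  fixes V :: "'v set" and E :: "'v set set" and n :: nat and v :: "nat \<Rightarrow> 'v"
    and m :: "'v \<Rightarrow> int" and r :: "'v set \<Rightarrow> int" and F :: "nat \<Rightarrow> 'v \<Rightarrow> int"
  assumes "ordered_graph V E n v"
    and "\<And>i. i \<in> {1..n} \<Longrightarrow> F i \<in> flow_up_classes V E m r v i"
  shows "tuple_module_basis (F ` {1..n}) (splines V E m r) \<longleftrightarrow>
    (\<forall>i\<in>{1..n}. \<forall>A\<in>flow_up_classes V E m r v i. F i (v i) dvd A (v i))"
proof -
  interpret flow_up_family V E n v m r F
    using assms by unfold_locales (auto simp: ordered_graph_def bij_betw_def)
  show ?thesis
  proof
    assume "tuple_module_basis (F ` {1..n}) (splines V E m r)"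
    then show "\<forall>i\<in>{1..n}. \<forall>A\<in>flow_up_classes V E m r v i. F i (v i) dvd A (v i)"
      by (auto simp: tuple_module_basis_def flow_up_classes_def intro!: dvd_leading_entry)
  next
    assume "\<forall>i\<in>{1..n}. \<forall>A\<in>flow_up_classes V E m r v i. F i (v i) dvd A (v i)"
    then have "splines V E m r \<subseteq> tuple.span (F ` {1..n})"
      \<comment> \<open>For \<open>i = 1\<close> the vanishing condition is empty, so every spline
        qualifies.\<close>
      using spline_in_span[where i = 1] by auto
    then show "tuple_module_basis (F ` {1..n}) (splines V E m r)"
      using independent_family span_family_subset by (simp add: tuple_module_basis_def)
  qed
qed

end
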